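(* Let $c$ be a real constant, $m_1,m_2>0$, $w>0$, and let $g=-\frac{dT^2}{(V+cT)^2}+(V+cT)^2\,(d\rho^2+\rho^2d\phi^2+dz^2)$ be the two-centre Kastor-Traschen metric, with $$V=\frac{m_1}{(\rho^2+(z-w)^2)^{1/2}}+\frac{m_2}{(\rho^2+(z+w)^2)^{1/2}}.$$ If the retraction projection of a null geodesic of $g$ has the property that its initial position and initial velocity lie in a plane of $\mathbb{R}^3$ passing through the two centres (the points $\rho=0$, $z=\pm w$), then the entire projected null geodesic lies in that plane.
   Context: $(\rho,\phi,z)$ are cylindrical polar coordinates on $\mathbb{R}^3$, so $d\rho^2+\rho^2d\phi^2+dz^2$ is the flat Euclidean metric. The metric $g$ is considered on the set of $(T,\mathbf{x})$, $T\in\mathbb{R}$, $\mathbf{x}\in\mathbb{R}^3$ different from the two centres, where $V(\mathbf{x})+cT\neq0$. The retraction projection of a curve $(T(s),\mathbf{x}(s))$ is its spatial part $\mathbf{x}(s)\in\mathbb{R}^3$, i.e. its image in the space of orbits of $\partial/\partial T$. "Initial velocity lies in the plane" means that the velocity vector is tangent to the plane. *)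

theory Defs
  imports "HOL-Analysis.Analysis"
begin

section \<open>Geodesics of a pseudo-Riemannian metric in coordinates\<close>

text \<open>A metric on an open subset of \<open>\<real>\<^sup>n\<close> is given by its component matrix
  \<open>g p $ i $ j\<close> at each point \<open>p\<close>.\<close>

definition partial_deriv :: "'n::finite \<Rightarrow> (real^'n \<Rightarrow> real) \<Rightarrow> real^'n \<Rightarrow> real" where
  "partial_deriv i f p = deriv (\<lambda>t. f (p + t *\<^sub>R axis i 1)) 0"

text \<open>\<open>christoffel g p i j k\<close> is \<open>\<Gamma>\<^sup>i\<^sub>j\<^sub>k\<close>, of the Levi-Civita connection of \<open>g\<close>.\<close>

definition christoffel ::
  "(real^'n::finite \<Rightarrow> real^'n^'n) \<Rightarrow> real^'n \<Rightarrow> 'n \<Rightarrow> 'n \<Rightarrow> 'n \<Rightarrow> real" where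
  "christoffel g p i j k = (1/2) * (\<Sum>l\<in>UNIV. matrix_inv (g p) $ i $ l *
      (partial_deriv j (\<lambda>q. g q $ l $ k) p + partial_deriv k (\<lambda>q. g q $ l $ j) p
       - partial_deriv l (\<lambda>q. g q $ j $ k) p))"

text \<open>Geodesics are affinely parametrised, on an arbitrary nondegenerate interval \<open>I\<close>;
  derivatives at endpoints belonging to \<open>I\<close> are one-sided.\<close>

definition geodesic_on ::
  "(real^'n::finite \<Rightarrow> real^'n^'n) \<Rightarrow> (real^'n) set \<Rightarrow> real set \<Rightarrow> (real \<Rightarrow> real^'n) \<Rightarrow> bool" where
  "geodesic_on g U I \<gamma> \<longleftrightarrow> is_interval I \<and> interior I \<noteq> {} \<and> \<gamma> ` I \<subseteq> U \<and>
     (\<exists>v a. \<forall>s\<in>I. (\<gamma> has_vector_derivative v s) (at s within I) \<and>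
        (v has_vector_derivative a s) (at s within I) \<and>
        (\<forall>i. a s $ i + (\<Sum>j\<in>UNIV. \<Sum>k\<in>UNIV. christoffel g (\<gamma> s) i j k * v s $ j * v s $ k) = 0))"

text \<open>Constant curves are not excluded.\<close>

definition null_geodesic_on ::
  "(real^'n::finite \<Rightarrow> real^'n^'n) \<Rightarrow> (real^'n) set \<Rightarrow> real set \<Rightarrow> (real \<Rightarrow> real^'n) \<Rightarrow> bool" where
  "null_geodesic_on g U I \<gamma> \<longleftrightarrow> geodesic_on g U I \<gamma> \<and>
     (\<forall>s\<in>I. let v = vector_derivative \<gamma> (at s within I) in v \<bullet> (g (\<gamma> s) *v v) = 0)"

section \<open>The two-centre Kastor-Traschen metric\<close>

text \<open>The coordinates on \<open>\<real>\<^sup>4\<close> are \<open>(T, x, y, z)\<close>, with indices 1, 2, 3, 4, where \<open>(x, y, z)\<close> are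
  the Cartesian coordinates with \<open>x = \<rho> cos \<phi>\<close>, \<open>y = \<rho> sin \<phi>\<close>. Thus
  \<open>d\<rho>\<^sup>2 + \<rho>\<^sup>2 d\<phi>\<^sup>2 + dz\<^sup>2 = dx\<^sup>2 + dy\<^sup>2 + dz\<^sup>2\<close>, and the axis \<open>\<rho> = 0\<close> away from the centres is
  covered as well.\<close>

definition spatial_part :: "real^4 \<Rightarrow> real^3" where
  "spatial_part p = vector [p $ 2, p $ 3, p $ 4]"

definition centre :: "real \<Rightarrow> real^3" where
  "centre h = vector [0, 0, h]"

definition cyl_rho :: "real^3 \<Rightarrow> real" where
  "cyl_rho x = sqrt ((x $ 1)\<^sup>2 + (x $ 2)\<^sup>2)"

definition two_centre_V :: "real \<Rightarrow> real \<Rightarrow> real \<Rightarrow> real^3 \<Rightarrow> real" where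
  "two_centre_V m1 m2 w x = m1 / sqrt ((cyl_rho x)\<^sup>2 + (x $ 3 - w)\<^sup>2)
                          + m2 / sqrt ((cyl_rho x)\<^sup>2 + (x $ 3 + w)\<^sup>2)"

definition KT_factor :: "real \<Rightarrow> real \<Rightarrow> real \<Rightarrow> real \<Rightarrow> real^4 \<Rightarrow> real" where
  "KT_factor c m1 m2 w p = two_centre_V m1 m2 w (spatial_part p) + c * p $ 1"

definition KT_metric :: "real \<Rightarrow> real \<Rightarrow> real \<Rightarrow> real \<Rightarrow> real^4 \<Rightarrow> real^4^4" where
  "KT_metric c m1 m2 w p = (\<chi> i j. if i \<noteq> j then 0
      else if i = 1 then - 1 / (KT_factor c m1 m2 w p)\<^sup>2 else (KT_factor c m1 m2 w p)\<^sup>2)"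

definition KT_domain :: "real \<Rightarrow> real \<Rightarrow> real \<Rightarrow> real \<Rightarrow> (real^4) set" where
  "KT_domain c m1 m2 w = {p. spatial_part p \<noteq> centre w \<and> spatial_part p \<noteq> centre (- w) \<and>
                             KT_factor c m1 m2 w p \<noteq> 0}"

section \<open>Planes in \<open>\<real>\<^sup>3\<close>\<close>

definition is_plane :: "(real^3) set \<Rightarrow> bool" where
  "is_plane P \<longleftrightarrow> affine P \<and> aff_dim P = 2"

definition tangent_vectors :: "(real^3) set \<Rightarrow> (real^3) set" where
  "tangent_vectors P = {p - q | p q. p \<in> P \<and> q \<in> P}"

end

theory Submission
  imports Defs
begin

text \<open>The plane contains the \<open>z\<close>-axis, so it is \<open>n1 x + n2 y = 0\<close> for some \<open>n1, n2\<close>. By axial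
  symmetry \<open>\<partial>V/\<partial>x = -F x\<close> and \<open>\<partial>V/\<partial>y = -F y\<close> with the same factor \<open>F\<close>, so the \<open>x\<close> and \<open>y\<close>
  components of the geodesic equation combine to a homogeneous linear equation
  \<open>u'' = \<alpha> u' + \<beta> u\<close> for \<open>u = n1 x + n2 y\<close> along the geodesic, with continuous coefficients
  \<open>\<alpha>, \<beta>\<close>. The initial data give \<open>u = u' = 0\<close> at one parameter value, so \<open>u\<close> vanishes.\<close>

section \<open>Uniqueness for homogeneous linear second-order equations\<close>

text \<open>On a compact interval \<alpha> and \<beta> are bounded, so the energy
  \<open>E = u^2 + u'^2\<close> satisfies \<open>\<bar>E'\<bar> \<le> K * E\<close>. It vanishes at
  \<open>s0\<close>, hence everywhere by Gronwall.\<close>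

lemma second_order_linear_ode_zero_on_interval:
  fixes u u' \<alpha> \<beta> :: "real \<Rightarrow> real"
  assumes u: "\<And>s. s \<in> {a..b} \<Longrightarrow> (u has_real_derivative u' s) (at s within {a..b})"
    and u': "\<And>s. s \<in> {a..b} \<Longrightarrow>
      (u' has_real_derivative \<alpha> s * u' s + \<beta> s * u s) (at s within {a..b})"
    and cont: "continuous_on {a..b} \<alpha>" "continuous_on {a..b} \<beta>"
    and s0: "s0 \<in> {a..b}" "u s0 = 0" "u' s0 = 0"
    and s: "s \<in> {a..b}"
  shows "u s = 0"
proof -
  obtain A where A: "\<And>s. s \<in> {a..b} \<Longrightarrow> \<bar>\<alpha> s\<bar> \<le> A"
    using compact_imp_bounded[OF compact_continuous_image[OF cont(1) compact_Icc]]
    unfolding bounded_iff by (metis imageI real_norm_def)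
  obtain B where B: "\<And>s. s \<in> {a..b} \<Longrightarrow> \<bar>\<beta> s\<bar> \<le> B"
    using compact_imp_bounded[OF compact_continuous_image[OF cont(2) compact_Icc]]
    unfolding bounded_iff by (metis imageI real_norm_def)
  \<comment> \<open>\<open>E'\<close> is a cross term \<open>(1 + \<beta>) * 2 * u * u'\<close> plus
    \<open>2 * \<alpha> * u'^2\<close>. Since both \<open>2 * \<bar>u * u'\<bar>\<close> and
    \<open>u'^2\<close> are at most \<open>E\<close>, the first costs \<open>1 + B\<close> and the
    second \<open>2 * A\<close>.\<close>
  define K where "K = 1 + 2 * A + B"
  define E where "E = (\<lambda>s. (u s)\<^sup>2 + (u' s)\<^sup>2)"
  define E' where "E' = (\<lambda>s. 2 * u s * u' s + 2 * u' s * (\<alpha> s * u' s + \<beta> s * u s))"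
  have dE: "(E has_real_derivative E' t) (at t within {a..b})" if "t \<in> {a..b}" for t
    unfolding E_def E'_def
    by (rule derivative_eq_intros u[OF that] u'[OF that] refl)+ (simp add: algebra_simps)
  have bound: "\<bar>E' t\<bar> \<le> K * E t" if "t \<in> {a..b}" for t
  proof -
    have uv: "2 * \<bar>u t * u' t\<bar> \<le> E t"
      using sum_squares_bound[of "\<bar>u t\<bar>" "\<bar>u' t\<bar>"] by (simp add: E_def abs_mult)
    have "E' t = (1 + \<beta> t) * (2 * (u t * u' t)) + 2 * \<alpha> t * (u' t)\<^sup>2"
      by (simp add: E'_def power2_eq_square algebra_simps)
    also have "\<bar>\<dots>\<bar> \<le> \<bar>1 + \<beta> t\<bar> * (2 * \<bar>u t * u' t\<bar>) + 2 * \<bar>\<alpha> t\<bar> * (u' t)\<^sup>2"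
      by (rule order_trans[OF abs_triangle_ineq]) (simp add: abs_mult)
    also have "\<dots> \<le> (1 + B) * E t + 2 * A * E t"
      using A[OF that] B[OF that] uv by (intro add_mono mult_mono) (auto simp: E_def)
    finally show ?thesis by (simp add: K_def algebra_simps)
  qed
  \<comment> \<open>Gronwall: \<open>E e\<^bsup>-Ks\<^esup>\<close> decreases, which handles \<open>s \<ge> s0\<close>;
    \<open>E e\<^bsup>Ks\<^esup>\<close> increases, which handles \<open>s \<le> s0\<close>.\<close>
  have dG: "((\<lambda>t. E t * exp (k * t)) has_derivative
      (\<lambda>h. h * ((E' t + k * E t) * exp (k * t)))) (at t within {l..r})"
    if "{l..r} \<subseteq> {a..b}" "t \<in> {l..r}" for k t l r
  proof -
    have "((\<lambda>t. E t * exp (k * t)) has_real_derivative (E' t + k * E t) * exp (k * t))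
        (at t within {l..r})"
      using that
      by (auto intro!: derivative_eq_intros DERIV_subset[OF dE that(1)] simp: algebra_simps)
    then show ?thesis by (simp add: has_field_derivative_def mult_commute_abs)
  qed
  have E0: "E s0 = 0" using s0 by (simp add: E_def)
  have "E s \<le> 0"
  proof (cases "s0 \<le> s")
    case True
    have sub: "{s0..s} \<subseteq> {a..b}" using s s0 by auto
    from mvt_very_simple[OF True dG[OF sub, of _ "-K"]] obtain t where
      "t \<in> {s0..s}" "E s * exp (-K * s) = (s - s0) * ((E' t - K * E t) * exp (-K * t))"
      using E0 by auto
    moreover have "\<dots> \<le> 0"
      using bound[of t] True sub \<open>t \<in> _\<close> by (intro mult_nonneg_nonpos mult_nonpos_nonneg) auto
    ultimately have "E s * exp (-K * s) \<le> 0" by linarith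
    then show ?thesis by (simp add: mult_le_0_iff)
  next
    case False
    then have le: "s \<le> s0" by simp
    have sub: "{s..s0} \<subseteq> {a..b}" using s s0 by auto
    from mvt_very_simple[OF le dG[OF sub, of _ K]] obtain t where
      "t \<in> {s..s0}" "- (E s * exp (K * s)) = (s0 - s) * ((E' t + K * E t) * exp (K * t))"
      using E0 by auto
    moreover have "\<dots> \<ge> 0"
      using bound[of t] le sub \<open>t \<in> _\<close> by (intro mult_nonneg_nonneg) auto
    ultimately have "E s * exp (K * s) \<le> 0" by linarith
    then show ?thesis by (simp add: mult_le_0_iff)
  qed
  then show ?thesis
    by (simp add: E_def sum_power2_le_zero_iff)
qed

text \<open>On a general interval the coefficients may be unbounded, so the compact case is applied
  to the segment between \<open>s0\<close> and \<open>s\<close> only.\<close>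

lemma second_order_linear_ode_zero:
  fixes u u' \<alpha> \<beta> :: "real \<Rightarrow> real"
  assumes I: "is_interval I"
    and u: "\<And>s. s \<in> I \<Longrightarrow> (u has_real_derivative u' s) (at s within I)"
    and u': "\<And>s. s \<in> I \<Longrightarrow> (u' has_real_derivative \<alpha> s * u' s + \<beta> s * u s) (at s within I)"
    and cont: "continuous_on I \<alpha>" "continuous_on I \<beta>"
    and s0: "s0 \<in> I" "u s0 = 0" "u' s0 = 0"
    and s: "s \<in> I"
  shows "u s = 0"
proof -
  have sub: "{min s0 s..max s0 s} \<subseteq> I"
  proof
    fix t assume t: "t \<in> {min s0 s..max s0 s}"
    have "min s0 s \<in> I" "max s0 s \<in> I" using s0(1) s by (simp_all add: min_def max_def)
    from mem_is_interval_1_I[OF I this] show "t \<in> I" using t by simp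
  qed
  have du: "(u has_real_derivative u' t) (at t within {min s0 s..max s0 s})"
    and du': "(u' has_real_derivative \<alpha> t * u' t + \<beta> t * u t) (at t within {min s0 s..max s0 s})"
    if "t \<in> {min s0 s..max s0 s}" for t
    using DERIV_subset[OF u sub] DERIV_subset[OF u' sub] subsetD[OF sub that] by blast+
  have "continuous_on {min s0 s..max s0 s} \<alpha>" "continuous_on {min s0 s..max s0 s} \<beta>"
    using cont sub by (auto intro: continuous_on_subset)
  from second_order_linear_ode_zero_on_interval[OF du du' this _ s0(2,3)] show ?thesis
    by simp
qed

section \<open>Planes containing both centres\<close>

text \<open>Write the plane as \<open>n \<bullet> x = b\<close>. The two centres give
  \<open>n $ 3 * w = b = - n $ 3 * w\<close>, which forces \<open>b = 0\<close> and
  \<open>n $ 3 = 0\<close> because \<open>w > 0\<close>.\<close>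

lemma plane_through_centres:
  assumes P: "is_plane P" and w: "w > 0" and cw: "centre w \<in> P" "centre (- w) \<in> P"
  obtains n1 n2 where "P = {x. n1 * x $ 1 + n2 * x $ 2 = 0}"
proof -
  have "aff_dim P = int (DIM(real^3) - 1)" using P by (simp add: is_plane_def)
  then obtain n b where "affine hull P = {x. n \<bullet> x = b}"
    using aff_dim_eq_hyperplane[of P] by auto
  moreover have "affine hull P = P"
    using P by (simp only: is_plane_def affine_hull_eq)
  ultimately have Pn: "P = {x. n \<bullet> x = b}" by simp
  from cw have "n $ 3 * w = b" "n $ 3 * (- w) = b"
    by (auto simp: Pn centre_def inner_vec_def sum_3)
  then have "b = 0" "n $ 3 = 0" using w by auto
  then have "P = {x. n $ 1 * x $ 1 + n $ 2 * x $ 2 = 0}"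
    by (auto simp: Pn inner_vec_def sum_3)
  then show ?thesis by (rule that)
qed

section \<open>Partial derivatives of \<open>KT_factor\<close>\<close>

text \<open>\<open>cyl_rho\<close> is not differentiable on the axis, but only its square enters V;
  the Cartesian form makes this visible.\<close>

definition centre_dist :: "real \<Rightarrow> real^4 \<Rightarrow> real" where
  "centre_dist h p = sqrt ((p $ 2)\<^sup>2 + (p $ 3)\<^sup>2 + (p $ 4 - h)\<^sup>2)"

lemma KT_factor_eq:
  "KT_factor c m1 m2 w p = m1 / centre_dist w p + m2 / centre_dist (- w) p + c * p $ 1"
  by (simp add: KT_factor_def two_centre_V_def cyl_rho_def spatial_part_def centre_dist_def)

lemma centre_dist_pos:
  assumes "spatial_part p \<noteq> centre h"
  shows "centre_dist h p > 0"
proof -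
  have "\<not> (p $ 2 = 0 \<and> p $ 3 = 0 \<and> p $ 4 - h = 0)"
    using assms by (auto simp: spatial_part_def centre_def)
  then have "(p $ 2)\<^sup>2 + (p $ 3)\<^sup>2 + (p $ 4 - h)\<^sup>2 \<noteq> 0"
    by (auto simp: add_nonneg_eq_0_iff)
  then show ?thesis
    unfolding centre_dist_def by (simp add: order_less_le)
qed

text \<open>The factor F shared by the x and y derivatives of V. The z derivative has no such form,
  as the centres lie at different heights.\<close>

definition attraction :: "real \<Rightarrow> real \<Rightarrow> real \<Rightarrow> real^4 \<Rightarrow> real" where
  "attraction m1 m2 w p = m1 / centre_dist w p ^ 3 + m2 / centre_dist (- w) p ^ 3"

definition KT_grad :: "real \<Rightarrow> real \<Rightarrow> real \<Rightarrow> real \<Rightarrow> real^4 \<Rightarrow> real^4" where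
  "KT_grad c m1 m2 w p = vector [c, - (attraction m1 m2 w p * p $ 2),
     - (attraction m1 m2 w p * p $ 3),
     - (m1 * (p $ 4 - w) / centre_dist w p ^ 3 + m2 * (p $ 4 + w) / centre_dist (- w) p ^ 3)]"

text \<open>An arbitrary direction \<open>d\<close> treats all four partial derivatives at
  once.\<close>

lemma inverse_centre_dist_derivative:
  assumes "spatial_part p \<noteq> centre h"
  shows "((\<lambda>t. m / centre_dist h (p + t *\<^sub>R d)) has_real_derivative
    - (m * (p $ 2 * d $ 2 + p $ 3 * d $ 3 + (p $ 4 - h) * d $ 4) / centre_dist h p ^ 3)) (at 0)"
proof -
  define r where "r = centre_dist h p"
  have r: "r > 0" using centre_dist_pos[OF assms] by (simp add: r_def)
  then have pos: "(p $ 2)\<^sup>2 + (p $ 3)\<^sup>2 + (p $ 4 - h)\<^sup>2 > 0"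
    by (simp add: r_def centre_dist_def)
  have "((\<lambda>t. centre_dist h (p + t *\<^sub>R d)) has_real_derivative
      (p $ 2 * d $ 2 + p $ 3 * d $ 3 + (p $ 4 - h) * d $ 4) / r) (at 0)"
    unfolding centre_dist_def r_def
    using pos by (auto intro!: derivative_eq_intros simp: field_simps)
  moreover have "centre_dist h (p + 0 *\<^sub>R d) = r" by (simp add: r_def)
  ultimately show ?thesis
    unfolding r_def[symmetric] using r
    by (auto intro!: derivative_eq_intros simp: field_simps power3_eq_cube)
qed

lemma vector_4:
  "(vector [x, y, z, t] :: 'a::zero^4) $ 1 = x"
  "(vector [x, y, z, t] :: 'a^4) $ 2 = y"
  "(vector [x, y, z, t] :: 'a^4) $ 3 = z"
  "(vector [x, y, z, t] :: 'a^4) $ 4 = t"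
  by (simp_all add: vector_def)

lemma KT_factor_derivative:
  assumes "p \<in> KT_domain c m1 m2 w"
  shows "((\<lambda>t. KT_factor c m1 m2 w (p + t *\<^sub>R axis j 1)) has_real_derivative
    KT_grad c m1 m2 w p $ j) (at 0)"
proof -
  have ne: "spatial_part p \<noteq> centre w" "spatial_part p \<noteq> centre (- w)"
    using assms by (auto simp: KT_domain_def)
  have r: "centre_dist w p > 0" "centre_dist (- w) p > 0"
    using ne by (auto intro: centre_dist_pos)
  have "((\<lambda>t. KT_factor c m1 m2 w (p + t *\<^sub>R d)) has_real_derivative
      - (m1 * (p $ 2 * d $ 2 + p $ 3 * d $ 3 + (p $ 4 - w) * d $ 4) / centre_dist w p ^ 3)
      + - (m2 * (p $ 2 * d $ 2 + p $ 3 * d $ 3 + (p $ 4 - (- w)) * d $ 4)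
            / centre_dist (- w) p ^ 3) + c * d $ 1) (at 0)" for d
    unfolding KT_factor_eq
    by (intro DERIV_add inverse_centre_dist_derivative ne) (auto intro!: derivative_eq_intros)
  from this[of "axis j 1"] show ?thesis
    using exhaust_4[of j] r
    by (auto simp: KT_grad_def attraction_def axis_def vector_4 field_simps elim!: DERIV_cong)
qed

section \<open>Christoffel symbols of the metric\<close>

lemma partial_deriv_KT_metric:
  assumes "p \<in> KT_domain c m1 m2 w"
  shows "partial_deriv j (\<lambda>q. KT_metric c m1 m2 w q $ l $ k) p =
    (if l \<noteq> k then 0
     else if l = 1 then 2 * KT_grad c m1 m2 w p $ j / KT_factor c m1 m2 w p ^ 3
     else 2 * KT_factor c m1 m2 w p * KT_grad c m1 m2 w p $ j)"
proof -
  let ?U = "KT_factor c m1 m2 w" and ?D = "KT_grad c m1 m2 w p $ j"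
  have U: "?U p \<noteq> 0" using assms by (simp add: KT_domain_def)
  note D = KT_factor_derivative[OF assms, of j]
  have 1: "((\<lambda>t. - 1 / (?U (p + t *\<^sub>R axis j 1))\<^sup>2) has_real_derivative 2 * ?D / ?U p ^ 3) (at 0)"
    using U by (auto intro!: derivative_eq_intros D
        simp: field_simps power2_eq_square power3_eq_cube)
  have 2: "((\<lambda>t. (?U (p + t *\<^sub>R axis j 1))\<^sup>2) has_real_derivative 2 * ?U p * ?D) (at 0)"
    by (auto intro!: derivative_eq_intros D)
  show ?thesis
    using DERIV_imp_deriv[OF 1] DERIV_imp_deriv[OF 2]
    by (auto simp: partial_deriv_def KT_metric_def)
qed

text \<open>\<open>matrix_inv\<close> chooses some two-sided inverse, so one must be exhibited
  first: for square matrices a left inverse is also a right inverse. Cancelling \<open>A\<close>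
  then identifies the choice with \<open>B\<close>.\<close>

lemma matrix_inv_eqI:
  fixes A B :: "'a::field^'n^'n"
  assumes "B ** A = mat 1"
  shows "matrix_inv A = B"
proof -
  have "\<exists>A'. A ** A' = mat 1 \<and> A' ** A = mat 1"
    using assms matrix_left_right_inverse by blast
  then have "A ** matrix_inv A = mat 1"
    unfolding matrix_inv_def by (rule someI2_ex) simp
  then have "B ** A ** matrix_inv A = B" by (simp add: matrix_mul_assoc[symmetric])
  then show ?thesis by (simp add: assms)
qed

lemma matrix_inv_KT_metric:
  assumes "p \<in> KT_domain c m1 m2 w"
  shows "matrix_inv (KT_metric c m1 m2 w p) = (\<chi> i j. if i \<noteq> j then 0
      else if i = 1 then - (KT_factor c m1 m2 w p)\<^sup>2 else 1 / (KT_factor c m1 m2 w p)\<^sup>2)"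
proof -
  have U: "KT_factor c m1 m2 w p \<noteq> 0" using assms by (simp add: KT_domain_def)
  show ?thesis
    by (rule matrix_inv_eqI)
      (use U in \<open>auto simp: vec_eq_iff forall_4 matrix_matrix_mult_def sum_4 mat_def KT_metric_def\<close>)
qed

text \<open>This splits the connection term into a multiple of \<open>v $ i\<close> and a multiple
  of the gradient component, with factors independent of \<open>i\<close>; that makes the x and y
  equations combinable.\<close>

lemma christoffel_KT_spatial:
  assumes p: "p \<in> KT_domain c m1 m2 w" and i: "i \<noteq> 1"
  shows "(\<Sum>j\<in>UNIV. \<Sum>k\<in>UNIV. christoffel (KT_metric c m1 m2 w) p i j k * v $ j * v $ k) =
    2 * (KT_grad c m1 m2 w p \<bullet> v) / KT_factor c m1 m2 w p * v $ i
    - KT_grad c m1 m2 w p $ i * ((v $ 1)\<^sup>2 / KT_factor c m1 m2 w p ^ 5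
        + ((v $ 2)\<^sup>2 + (v $ 3)\<^sup>2 + (v $ 4)\<^sup>2) / KT_factor c m1 m2 w p)"
proof -
  let ?U = "KT_factor c m1 m2 w p" and ?D = "KT_grad c m1 m2 w p"
  have U: "?U \<noteq> 0" using p by (simp add: KT_domain_def)
  \<comment> \<open>The first two terms differentiate the spatial coefficient \<open>U^2\<close>,
    also along T. The last is the i-th derivative of the (j,k) entry; for \<open>j = k = 1\<close>
    the inverse metric \<open>1 / U^2\<close> meets \<open>2 * D_i / U^3\<close>, whence the fifth
    power.\<close>
  have \<Gamma>: "christoffel (KT_metric c m1 m2 w) p i j k =
      (if i = k then ?D $ j / ?U else 0) + (if i = j then ?D $ k / ?U else 0)
      - (if j = k then if j = 1 then ?D $ i / ?U ^ 5 else ?D $ i / ?U else 0)" for j k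
    unfolding christoffel_def matrix_inv_KT_metric[OF p] partial_deriv_KT_metric[OF p]
    using i U exhaust_4[of i]
    by (auto simp: sum_4 field_simps power2_eq_square power3_eq_cube eval_nat_numeral)
  show ?thesis
    unfolding \<Gamma>
    using i exhaust_4[of i]
    by (auto simp: sum_4 inner_vec_def algebra_simps add_divide_distrib diff_divide_distrib
        power2_eq_square)
qed

section \<open>The linear equation for \<open>u\<close> along the geodesic\<close>

theorem proposition7p1:
  fixes c m1 m2 w s0 :: real and I :: "real set"
    and \<gamma> :: "real \<Rightarrow> real^4" and P :: "(real^3) set"
  assumes "m1 > 0" and "m2 > 0" and "w > 0"
    and "null_geodesic_on (KT_metric c m1 m2 w) (KT_domain c m1 m2 w) I \<gamma>"
    and "is_plane P" and "centre w \<in> P" and "centre (- w) \<in> P"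
    and "s0 \<in> I"
    and "spatial_part (\<gamma> s0) \<in> P"
    and "vector_derivative (\<lambda>s. spatial_part (\<gamma> s)) (at s0 within I) \<in> tangent_vectors P"
  shows "\<forall>s\<in>I. spatial_part (\<gamma> s) \<in> P"
proof
  fix s assume s: "s \<in> I"
  let ?g = "KT_metric c m1 m2 w" and ?U = "KT_factor c m1 m2 w" and ?D = "KT_grad c m1 m2 w"
  obtain n1 n2 where P: "P = {x. n1 * x $ 1 + n2 * x $ 2 = 0}"
    using plane_through_centres[OF assms(5,3,6,7)] .
  have "geodesic_on ?g (KT_domain c m1 m2 w) I \<gamma>"
    using assms(4) by (simp add: null_geodesic_on_def)
  then have I: "is_interval I" "interior I \<noteq> {}"
    and dom: "\<And>s. s \<in> I \<Longrightarrow> \<gamma> s \<in> KT_domain c m1 m2 w"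
    and "\<exists>v a. \<forall>s\<in>I. (\<gamma> has_vector_derivative v s) (at s within I) \<and>
      (v has_vector_derivative a s) (at s within I) \<and>
      (\<forall>i. a s $ i + (\<Sum>j\<in>UNIV. \<Sum>k\<in>UNIV. christoffel ?g (\<gamma> s) i j k * v s $ j * v s $ k) = 0)"
    unfolding geodesic_on_def by blast+
  then obtain v a where va: "\<forall>s\<in>I. (\<gamma> has_vector_derivative v s) (at s within I) \<and>
      (v has_vector_derivative a s) (at s within I) \<and>
      (\<forall>i. a s $ i + (\<Sum>j\<in>UNIV. \<Sum>k\<in>UNIV. christoffel ?g (\<gamma> s) i j k * v s $ j * v s $ k) = 0)"
    by (elim exE)
  have v: "(\<gamma> has_vector_derivative v s) (at s within I)"
    and a: "(v has_vector_derivative a s) (at s within I)"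
    and geo: "a s $ i + (\<Sum>j\<in>UNIV. \<Sum>k\<in>UNIV. christoffel ?g (\<gamma> s) i j k * v s $ j * v s $ k) = 0"
    if "s \<in> I" for s i
    using va that by blast+
  \<comment> \<open>\<open>vector_derivative\<close> is determined only at a limit point of
    \<open>I\<close>. Nonempty interior excludes a singleton, and a connected set with more than one
    point has no isolated points.\<close>
  have nontrivial: "at s0 within I \<noteq> bot"
  proof -
    have "\<nexists>x. I = {x}" using I(2) by (metis interior_singleton)
    then show ?thesis
      using connected_imp_perfect[of I s0] I(1) assms(8)
      by (auto simp: is_interval_connected trivial_limit_within)
  qed
  have comp: "((\<lambda>s. f s $ i) has_real_derivative f' $ i) (at s within I)"
    if "(f has_vector_derivative f') (at s within I)" for f :: "real \<Rightarrow> real^4" and f' s i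
    using bounded_linear.has_vector_derivative[OF bounded_linear_vec_nth that]
    by (simp add: has_real_derivative_iff_has_vector_derivative)
  have comp_cont: "continuous_on I (\<lambda>s. \<gamma> s $ i)" "continuous_on I (\<lambda>s. v s $ i)" for i
    using comp[OF v] comp[OF a] by (auto intro!: DERIV_continuous_on)
  define u where "u = (\<lambda>s. n1 * \<gamma> s $ 2 + n2 * \<gamma> s $ 3)"
  define u' where "u' = (\<lambda>s. n1 * v s $ 2 + n2 * v s $ 3)"
  \<comment> \<open>Both coefficients are read off \<open>christoffel_KT_spatial\<close>, with the x
    and y gradient components replaced by \<open>- attraction\<close> times the coordinate.
    Evaluated along the given curve they are functions of \<open>s\<close> alone, so the equation is
    linear in \<open>u\<close>.\<close>
  define \<alpha> where "\<alpha> = (\<lambda>s. - (2 * (?D (\<gamma> s) \<bullet> v s) / ?U (\<gamma> s)))"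
  define \<beta> where "\<beta> = (\<lambda>s. - (attraction m1 m2 w (\<gamma> s) * ((v s $ 1)\<^sup>2 / ?U (\<gamma> s) ^ 5
      + ((v s $ 2)\<^sup>2 + (v s $ 3)\<^sup>2 + (v s $ 4)\<^sup>2) / ?U (\<gamma> s))))"
  have du: "(u has_real_derivative u' s) (at s within I)" if "s \<in> I" for s
    unfolding u_def u'_def using comp[OF v[OF that]] by (auto intro!: derivative_eq_intros)
  have acc: "a s $ i = \<alpha> s * v s $ i + \<beta> s * \<gamma> s $ i" if "s \<in> I" "i = 2 \<or> i = 3" for s i
  proof -
    have "?D (\<gamma> s) $ i = - (attraction m1 m2 w (\<gamma> s) * \<gamma> s $ i)"
      using that(2) by (auto simp: KT_grad_def vector_4)
    moreover have "i \<noteq> 1" using that(2) by auto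
    ultimately have "a s $ i - \<alpha> s * v s $ i - \<beta> s * \<gamma> s $ i = 0"
      using geo[OF that(1), of i] christoffel_KT_spatial[OF dom[OF that(1)], of i "v s"]
      by (simp add: \<alpha>_def \<beta>_def mult.assoc mult.left_commute[of _ "\<gamma> s $ i"]
          mult.commute[of _ "\<gamma> s $ i"])
    then show ?thesis by simp
  qed
  have du': "(u' has_real_derivative \<alpha> s * u' s + \<beta> s * u s) (at s within I)" if "s \<in> I" for s
  proof -
    have "(u' has_real_derivative n1 * a s $ 2 + n2 * a s $ 3) (at s within I)"
      unfolding u'_def using comp[OF a[OF that]] by (auto intro!: derivative_eq_intros)
    then show ?thesis
      using acc[OF that] by (simp add: u_def u'_def algebra_simps)
  qed
  have nz: "centre_dist w (\<gamma> s) \<noteq> 0" "centre_dist (- w) (\<gamma> s) \<noteq> 0" "?U (\<gamma> s) \<noteq> 0"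
    if "s \<in> I" for s
    using dom[OF that] centre_dist_pos[of "\<gamma> s" w] centre_dist_pos[of "\<gamma> s" "- w"]
    by (auto simp: KT_domain_def)
  have cd: "continuous_on I (\<lambda>s. centre_dist h (\<gamma> s))" for h
    unfolding centre_dist_def by (intro continuous_intros comp_cont)
  have cF: "continuous_on I (\<lambda>s. attraction m1 m2 w (\<gamma> s))"
    unfolding attraction_def using nz by (intro continuous_intros cd) auto
  have cU: "continuous_on I (\<lambda>s. ?U (\<gamma> s))"
    unfolding KT_factor_eq using nz by (intro continuous_intros cd comp_cont) auto
  have "continuous_on I (\<lambda>s. ?D (\<gamma> s) $ i)" for i
  proof -
    \<comment> \<open>This is the z component; the T component is constant and the other two are
      \<open>attraction\<close> times a coordinate.\<close>
    have "continuous_on I (\<lambda>s. - (m1 * (\<gamma> s $ 4 - w) / centre_dist w (\<gamma> s) ^ 3)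
        - m2 * (\<gamma> s $ 4 + w) / centre_dist (- w) (\<gamma> s) ^ 3)"
      using nz by (intro continuous_intros cd comp_cont) auto
    then show ?thesis
      using exhaust_4[of i]
      by (auto simp: KT_grad_def vector_4 intro!: continuous_on_minus continuous_on_mult cF comp_cont)
  qed
  then have "continuous_on I (\<lambda>s. \<chi> i. ?D (\<gamma> s) $ i)"
    by (rule continuous_on_vec_lambda)
  then have cD: "continuous_on I (\<lambda>s. ?D (\<gamma> s))"
    by simp
  have "continuous_on I v"
    using a by (rule continuous_on_vector_derivative)
  then have "continuous_on I \<alpha>"
    unfolding \<alpha>_def using nz by (intro continuous_intros cU cD) auto
  moreover have "continuous_on I \<beta>"
    unfolding \<beta>_def using nz by (intro continuous_intros cF cU comp_cont) auto
  moreover have "u s0 = 0"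
    using assms(9) by (simp add: P u_def spatial_part_def)
  moreover have "u' s0 = 0"
  proof -
    let ?x' = "vector_derivative (\<lambda>s. spatial_part (\<gamma> s)) (at s0 within I)"
    have "linear spatial_part"
      by (rule linearI) (simp_all add: spatial_part_def vec_eq_iff forall_3)
    then have "bounded_linear spatial_part"
      by (simp add: linear_conv_bounded_linear)
    then have "((\<lambda>s. spatial_part (\<gamma> s)) has_vector_derivative spatial_part (v s0)) (at s0 within I)"
      by (rule bounded_linear.has_vector_derivative[OF _ v[OF assms(8)]])
    then have "?x' = spatial_part (v s0)"
      by (rule vector_derivative_within[OF nontrivial])
    moreover obtain p q where pq: "?x' = p - q" "p \<in> P" "q \<in> P"
      using assms(10) by (auto simp: tangent_vectors_def)
    \<comment> \<open>The equation of \<open>P\<close> is homogeneous, so differences of its points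
      satisfy it too.\<close>
    have "n1 * ?x' $ 1 + n2 * ?x' $ 2 = 0"
      using pq(2,3) unfolding pq(1) by (simp add: P right_diff_distrib)
    ultimately show ?thesis by (simp add: u'_def spatial_part_def)
  qed
  ultimately have "u s = 0"
    by (intro second_order_linear_ode_zero[OF I(1) du du' _ _ assms(8) _ _ s])
  then show "spatial_part (\<gamma> s) \<in> P"
    by (simp add: P u_def spatial_part_def)
qed

end
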